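(* For each $k\in\{1,2,3,4,5,6,7,10,11\}$ there exists a finite $(3,3)$-homogeneous orthomodular poset $L$ with at most $19$ atoms that has exactly $k$ pure states.
   Context: An orthomodular poset (OMP) is a poset $L$ with least element $0$ and greatest element $1$ and an order-reversing involution $x\mapsto x^{\perp}$ such that $x\wedge x^{\perp}=0$ and $x\vee x^{\perp}=1$, such that $x\vee y$ exists whenever $x\perp y$ (i.e. $x\le y^{\perp}$), and such that $x\le y$ implies $y=x\vee(y\wedge x^{\perp})$. For a finite OMP $L$, a block is a maximal (with respect to inclusion) set of pairwise orthogonal atoms. $L$ is $(n,m)$-homogeneous if every atom of $L$ is contained in exactly $n$ blocks and every block has exactly $m$ elements. A state on $L$ is a map $s:L\to[0,1]$ with $s(1)=1$ and $s(x\vee y)=s(x)+s(y)$ whenever $x\perp y$. $S(L)$ denotes the convex set of all states on $L$; a state is pure if it is an extreme point of $S(L)$. *)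

theory Defs
  imports Complex_Main "HOL-Algebra.Lattice"
begin

record 'a ortho_poset = "'a gorder" +
  ocompl :: "'a \<Rightarrow> 'a" (\<open>ocompl\<index> _\<close> [81] 80)

definition orthogonal :: "('a, 'm) ortho_poset_scheme \<Rightarrow> 'a \<Rightarrow> 'a \<Rightarrow> bool"
  where "orthogonal L x y \<longleftrightarrow> x \<sqsubseteq>\<^bsub>L\<^esub> ocompl\<^bsub>L\<^esub> y"

text \<open>
  The constants \<^const>\<open>join\<close> and \<^const>\<open>meet\<close> are choice terms that only denote the supremum and
  infimum when these exist. Hence existence is stated with \<^const>\<open>is_lub\<close> and \<^const>\<open>is_glb\<close>. In the
  orthomodular law the meet exists because it is the complement of the join of the orthogonal
  elements \<open>ocompl y\<close> and \<open>x\<close>, and \<open>x\<close> is orthogonal to this meet, so the join exists as well.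
\<close>

locale orthomodular_poset =
  partial_order L + weak_partial_order_bottom L + weak_partial_order_top L
  for L :: "('a, 'm) ortho_poset_scheme" (structure) +
  assumes ocompl_closed: "x \<in> carrier L \<Longrightarrow> ocompl x \<in> carrier L"
    and ocompl_involution: "x \<in> carrier L \<Longrightarrow> ocompl (ocompl x) = x"
    and ocompl_antitone:
      "\<lbrakk>x \<in> carrier L; y \<in> carrier L; x \<sqsubseteq> y\<rbrakk> \<Longrightarrow> ocompl y \<sqsubseteq> ocompl x"
    and ocompl_meet: "x \<in> carrier L \<Longrightarrow> is_glb L \<bottom> {x, ocompl x}"
    and ocompl_join: "x \<in> carrier L \<Longrightarrow> is_lub L \<top> {x, ocompl x}"
    and orthogonal_join_exists:
      "\<lbrakk>x \<in> carrier L; y \<in> carrier L; orthogonal L x y\<rbrakk> \<Longrightarrow> \<exists>j. is_lub L j {x, y}"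
    and orthomodular:
      "\<lbrakk>x \<in> carrier L; y \<in> carrier L; x \<sqsubseteq> y\<rbrakk> \<Longrightarrow> y = x \<squnion> (y \<sqinter> ocompl x)"

definition atoms :: "('a, 'm) ortho_poset_scheme \<Rightarrow> 'a set"
  where "atoms L = {a \<in> carrier L. a \<noteq> \<bottom>\<^bsub>L\<^esub> \<and>
    (\<forall>x\<in>carrier L. x \<sqsubseteq>\<^bsub>L\<^esub> a \<longrightarrow> x = \<bottom>\<^bsub>L\<^esub> \<or> x = a)}"

definition orthogonal_atom_sets :: "('a, 'm) ortho_poset_scheme \<Rightarrow> 'a set set"
  where "orthogonal_atom_sets L = {B. B \<subseteq> atoms L \<and> pairwise (orthogonal L) B}"

definition blocks :: "('a, 'm) ortho_poset_scheme \<Rightarrow> 'a set set"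
  where "blocks L = {B \<in> orthogonal_atom_sets L. \<forall>C\<in>orthogonal_atom_sets L. B \<subseteq> C \<longrightarrow> C = B}"

text \<open>
  Intended for finite \<open>L\<close>: there every cardinality below is that of a finite set.
\<close>

definition homogeneous :: "nat \<Rightarrow> nat \<Rightarrow> ('a, 'm) ortho_poset_scheme \<Rightarrow> bool"
  where "homogeneous n m L \<longleftrightarrow>
    (\<forall>a\<in>atoms L. card {B \<in> blocks L. a \<in> B} = n) \<and> (\<forall>B\<in>blocks L. card B = m)"

text \<open>
  States are extensional functions (\<^const>\<open>undefined\<close> outside the carrier), so that two states are
  equal iff they agree on the carrier and counting states is meaningful.
\<close>

definition states :: "('a, 'm) ortho_poset_scheme \<Rightarrow> ('a \<Rightarrow> real) set"
  where "states L = {s \<in> carrier L \<rightarrow>\<^sub>E {0..1}. s \<top>\<^bsub>L\<^esub> = 1 \<and>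
    (\<forall>x\<in>carrier L. \<forall>y\<in>carrier L. orthogonal L x y \<longrightarrow> s (x \<squnion>\<^bsub>L\<^esub> y) = s x + s y)}"

text \<open>
  Extreme points of the set of states. The library's notion of extreme point needs a type of class
  \<^class>\<open>real_vector\<close>, which a function type is not, so its definition is written out here, with
  convex combinations taken pointwise on the carrier.
\<close>

definition pure_states :: "('a, 'm) ortho_poset_scheme \<Rightarrow> ('a \<Rightarrow> real) set"
  where "pure_states L = {s \<in> states L. \<not> (\<exists>s\<^sub>1\<in>states L. \<exists>s\<^sub>2\<in>states L. s\<^sub>1 \<noteq> s\<^sub>2 \<and>
    (\<exists>u::real. 0 < u \<and> u < 1 \<and> (\<forall>x\<in>carrier L. s x = (1 - u) * s\<^sub>1 x + u * s\<^sub>2 x)))}"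

end

theory Submission
  imports Defs
begin

text \<open>
  Orthogonality of the atoms of a \<open>(3, 3)\<close>-homogeneous orthomodular poset is a graph in which every
  edge lies in exactly one triangle and every vertex has six neighbours: the collinearity graph of
  a triangle-free configuration of three-point lines with three lines through each point.
  Conversely, every such graph yields an orthomodular poset, whose elements are the bounds, the
  atoms and their complements, and whose states are the nonnegative weights on the points with sum
  one on each line. The pure states are the weights of minimal support. For each \<open>k\<close> there is
  a configuration on 17, 18 or 19 points with exactly \<open>k\<close> of them; the configurations come from
  a computer search, and the weights of minimal support are checked against the incidences of
  the facets of the polytope of all weights.
\<close>

section \<open>The orthomodular poset of a triangle graph\<close>

text \<open>
  The points are \<open>1, \<dots>, n\<close>, and adjacency means collinearity. The point \<open>a\<close> is an atom,
  \<open>2 * n + 1 - a\<close> is its complement, and \<open>0\<close> and \<open>2 * n + 1\<close> are the bounds.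
\<close>

definition point_compl :: "nat \<Rightarrow> nat \<Rightarrow> nat"
  where "point_compl n x = 2 * n + 1 - x"

text \<open>As adjacency relates points only, the last disjunct puts a point below the complement of
  another exactly when the two are collinear. Apart from the bounds, these are the only proper
  comparisons.\<close>

definition point_le :: "nat \<Rightarrow> (nat \<Rightarrow> nat \<Rightarrow> bool) \<Rightarrow> nat \<Rightarrow> nat \<Rightarrow> bool"
  where "point_le n adj x y \<longleftrightarrow> x = y \<or> x = 0 \<or> y = 2 * n + 1 \<or> adj x (point_compl n y)"

definition point_poset :: "nat \<Rightarrow> (nat \<Rightarrow> nat \<Rightarrow> bool) \<Rightarrow> nat ortho_poset"
  where "point_poset n adj =
    \<lparr>carrier = {0..2 * n + 1}, eq = (=), le = point_le n adj, ortho_poset.ocompl = point_compl n\<rparr>"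

text \<open>Complementation has no fixed point because \<open>2 * n + 1\<close> is odd. The variants
  with \<open>Suc\<close> match the form into which the simplifier brings
  \<open>2 * n + 1\<close>.\<close>

lemma point_compl_simps [simp]:
  "x \<le> 2 * n + 1 \<Longrightarrow> point_compl n (point_compl n x) = x"
  "point_compl n x \<le> 2 * n + 1" "point_compl n x \<le> Suc (2 * n)"
  "point_compl n 0 = 2 * n + 1" "point_compl n (2 * n + 1) = 0" "point_compl n (Suc (2 * n)) = 0"
  "point_compl n x \<le> n \<longleftrightarrow> n < x" "point_compl n x \<noteq> x"
  "point_compl n x = 0 \<longleftrightarrow> 2 * n < x" "point_compl n x = Suc (2 * n) \<longleftrightarrow> x = 0"
  by (auto simp: point_compl_def) presburger

lemma point_compl_bounds:
  "0 < point_compl n x \<longleftrightarrow> x \<le> 2 * n" "point_compl n x \<le> 2 * n \<longleftrightarrow> 0 < x"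
  by (auto simp: point_compl_def)

lemma point_compl_eq_iff:
  "x \<le> 2 * n + 1 \<Longrightarrow> y \<le> 2 * n + 1 \<Longrightarrow> point_compl n x = y \<longleftrightarrow> x = point_compl n y"
  by (auto simp: point_compl_def)

text \<open>\<open>unique_third\<close> also excludes triangles formed by three different lines: any
  three pairwise adjacent points make up a block.\<close>

locale triangle_graph =
  fixes n :: nat and adj :: "nat \<Rightarrow> nat \<Rightarrow> bool"
  assumes n_pos: "0 < n"
    and adj_range: "adj a b \<Longrightarrow> a \<in> {1..n}"
    and adj_sym: "adj a b \<Longrightarrow> adj b a"
    and adj_irrefl: "\<not> adj a a"
    and unique_third: "adj a b \<Longrightarrow> \<exists>c. {x. adj a x \<and> adj b x} = {c}"
    and degree: "a \<in> {1..n} \<Longrightarrow> card {b. adj a b} = 6"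
begin

abbreviation L :: "nat ortho_poset"
  where "L \<equiv> point_poset n adj"

abbreviation compl :: "nat \<Rightarrow> nat"
  where "compl \<equiv> point_compl n"

abbreviation le_L :: "nat \<Rightarrow> nat \<Rightarrow> bool"  (infix \<open>\<preceq>\<close> 50)
  where "x \<preceq> y \<equiv> point_le n adj x y"

lemma L_simps [simp]:
  "carrier L = {0..2 * n + 1}" "le L = point_le n adj" "eq L = (=)" "ocompl\<^bsub>L\<^esub> x = compl x"
  by (simp_all add: point_poset_def)

lemma adj_bounds:
  assumes "adj a b"
  shows "1 \<le> a" "a \<le> n" "1 \<le> b" "b \<le> n" "a \<noteq> b"
  using adj_range[OF assms] adj_range[OF adj_sym[OF assms]] adj_irrefl assms by auto

lemma third_exists:
  assumes "adj a b"
  obtains c where "adj a c" "adj b c" "\<And>x. adj a x \<Longrightarrow> adj b x \<Longrightarrow> x = c"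
  using unique_third[OF assms] by auto

section \<open>The order and its complementation\<close>

lemma le_refl [simp]: "x \<preceq> x"
  and zero_le [simp]: "0 \<preceq> x"
  and le_top [simp]: "x \<preceq> 2 * n + 1" "x \<preceq> Suc (2 * n)"
  by (simp_all add: point_le_def)

text \<open>A comparison that is neither an equality nor involves a bound leads from an atom to a
  coatom; the order axioms below follow by splitting each comparison in this way.\<close>

lemma leE:
  assumes "x \<preceq> y"
  obtains "x = y" | "x = 0" | "y = 2 * n + 1"
  | "adj x (compl y)" "1 \<le> x" "x \<le> n" "n < y" "y \<le> 2 * n"
proof -
  have "n < y \<and> y \<le> 2 * n" if "adj x (compl y)"
    using adj_bounds(3,4)[OF that] point_compl_bounds(1)[of n y] by simp
  then show thesis
    using assms that adj_bounds[of x "compl y"] unfolding point_le_def by blast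
qed

lemma adj_imp_le:
  assumes "adj x y"
  shows "x \<preceq> compl y"
proof -
  have "compl (compl y) = y"
    using adj_bounds(4)[OF assms] by simp
  then show ?thesis
    using assms by (simp add: point_le_def)
qed

lemma le_compl_iff:
  assumes "x \<le> 2 * n + 1" "y \<le> 2 * n + 1"
  shows "x \<preceq> compl y \<longleftrightarrow> y = compl x \<or> x = 0 \<or> y = 0 \<or> adj x y"
  using assms point_compl_eq_iff[of x n y] point_compl_eq_iff[of y n "2 * n + 1"]
  by (auto simp: point_le_def)

text \<open>Two atom-to-coatom comparisons never compose, since the middle element would be both at
  most \<open>n\<close> and above \<open>n\<close>.\<close>

lemma le_trans:
  assumes "x \<preceq> y" "y \<preceq> z" "z \<le> 2 * n + 1"
  shows "x \<preceq> z"
  using assms(1)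
proof (cases rule: leE)
  case 4
  show ?thesis
    using assms(2) by (cases rule: leE) (use 4 assms in auto)
next
  case 3
  show ?thesis
    using assms(2) by (cases rule: leE) (use 3 assms in auto)
qed (use assms in auto)

lemma le_antisym:
  assumes "x \<preceq> y" "y \<preceq> x" "x \<le> 2 * n + 1" "y \<le> 2 * n + 1"
  shows "x = y"
  using assms(1)
proof (cases rule: leE)
  case 2
  show ?thesis
    using assms(2) by (cases rule: leE) (use 2 in simp_all)
next
  case 3
  show ?thesis
    using assms(2) by (cases rule: leE) (use 3 in simp_all)
next
  case 4
  show ?thesis
    using assms(2) by (cases rule: leE) (use 4 in simp_all)
qed

lemma compl_le:
  assumes "x \<le> 2 * n + 1" "y \<le> 2 * n + 1" "x \<preceq> y"
  shows "compl y \<preceq> compl x"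
  using assms(3)
proof (cases rule: leE)
  case 4
  then show ?thesis
    using adj_imp_le[OF adj_sym[OF 4(1)]] by simp
qed simp_all

sublocale partial_order L
  by unfold_locales (use le_antisym le_trans in auto)

lemma least_0: "least L 0 (carrier L)"
  and greatest_top: "greatest L (2 * n + 1) (carrier L)"
  by (auto simp: least_def greatest_def)

sublocale weak_partial_order_bottom L
  by unfold_locales (use least_0 in blast)

sublocale weak_partial_order_top L
  by unfold_locales (use greatest_top in blast)

lemma bottom_eq [simp]: "bottom L = 0"
  using least_unique[OF bottom_least least_0] .

lemma top_eq [simp]: "top L = 2 * n + 1"
  using greatest_unique[OF top_greatest greatest_top] .

section \<open>Suprema and infima\<close>

lemma join_eqI: "is_lub L j {x, y} \<Longrightarrow> join L x y = j"
  unfolding join_def sup_def by (rule some_equality) (auto intro: least_unique)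

lemma meet_eqI: "is_glb L j {x, y} \<Longrightarrow> meet L x y = j"
  unfolding meet_def inf_def by (rule some_equality) (auto intro: greatest_unique)

lemma is_lubI:
  assumes "x \<preceq> j" "y \<preceq> j" "x \<le> 2 * n + 1" "y \<le> 2 * n + 1" "j \<le> 2 * n + 1"
    and "\<And>z. z \<le> 2 * n + 1 \<Longrightarrow> x \<preceq> z \<Longrightarrow> y \<preceq> z \<Longrightarrow> j \<preceq> z"
  shows "is_lub L j {x, y}"
  using assms by (intro least_UpperI) (auto simp: Upper_def)

lemma is_lubD:
  assumes "is_lub L j {x, y}" "x \<le> 2 * n + 1" "y \<le> 2 * n + 1"
  shows "j \<le> 2 * n + 1" "x \<preceq> j" "y \<preceq> j"
    "z \<le> 2 * n + 1 \<Longrightarrow> x \<preceq> z \<Longrightarrow> y \<preceq> z \<Longrightarrow> j \<preceq> z"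
  using assms by (auto simp: least_def Upper_def)

text \<open>De Morgan: the antitone involution exchanges upper and lower bounds, so only suprema
  have to be computed from the order.\<close>

lemma lub_imp_glb:
  assumes "is_lub L j {x, y}" "x \<le> 2 * n + 1" "y \<le> 2 * n + 1"
  shows "is_glb L (compl j) {compl x, compl y}"
proof (rule greatest_LowerI)
  note j = is_lubD[OF assms]
  show "compl j \<sqsubseteq>\<^bsub>L\<^esub> z" if "z \<in> {compl x, compl y}" for z
    using that j compl_le assms by auto
  show "z \<sqsubseteq>\<^bsub>L\<^esub> compl j" if z: "z \<in> Lower L {compl x, compl y}" for z
  proof -
    have "z \<le> 2 * n + 1" "z \<preceq> compl x" "z \<preceq> compl y"
      using z by (auto simp: Lower_def)
    then have "x \<preceq> compl z" "y \<preceq> compl z"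
      using compl_le[of z "compl x"] compl_le[of z "compl y"] assms(2,3) by auto
    then have "j \<preceq> compl z"
      by (intro j(4)) auto
    then show ?thesis
      using compl_le[of j "compl z"] j(1) \<open>z \<le> 2 * n + 1\<close> by auto
  qed
qed auto

text \<open>The complement of \<open>z\<close> lies below \<open>x\<close> and below its complement.
  If it were nonzero, complementation would have a fixed point, \<open>adj\<close> a loop, or
  \<open>x\<close> and its complement would both be points.\<close>

lemma compl_upper_bound:
  assumes "x \<le> 2 * n + 1" "z \<le> 2 * n + 1" "x \<preceq> z" "compl x \<preceq> z"
  shows "z = 2 * n + 1"
proof -
  have "compl z \<preceq> x" "compl z \<preceq> compl x"
    using compl_le[of "compl x" z] compl_le[of x z] assms by simp_all
  then have "compl z = 0"
    using point_compl_simps(8)[of n x] adj_irrefl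
    by (elim leE) (auto dest: adj_bounds(2,4) simp: assms)
  then show ?thesis
    using assms(2) point_compl_eq_iff[of z n 0] by simp
qed

lemma lub_compl: "x \<le> 2 * n + 1 \<Longrightarrow> is_lub L (2 * n + 1) {x, compl x}"
  using compl_upper_bound[of x] by (intro is_lubI) (simp_all, force)

lemma lub_zero: "x \<le> 2 * n + 1 \<Longrightarrow> is_lub L x {0, x}" "x \<le> 2 * n + 1 \<Longrightarrow> is_lub L x {x, 0}"
  by (auto intro!: is_lubI)

text \<open>An upper bound of \<open>a\<close> and \<open>b\<close> other than the top is a coatom
  whose complement is adjacent to both, and the third point of the block is the only such
  point.\<close>

lemma lub_adj:
  assumes "adj a b" "adj a c" "adj b c"
  shows "is_lub L (compl c) {a, b}"
proof (rule is_lubI)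
  note bounds = adj_bounds[OF assms(1)] adj_bounds[OF assms(2)]
  show "compl c \<preceq> z" if z: "z \<le> 2 * n + 1" "a \<preceq> z" "b \<preceq> z" for z
    using z(2)
  proof (cases rule: leE)
    case 4
    show ?thesis
      using z(3)
    proof (cases rule: leE)
      case b: 4
      from third_exists[OF assms(1)] have "compl z = c"
        using 4(1) b(1) assms by metis
      then show ?thesis
        using z(1) by auto
    qed (use 4 bounds in auto)
  next
    case 1
    show ?thesis
      using z(3) by (cases rule: leE) (use 1 bounds in auto)
  qed (use bounds in auto)
qed (use assms adj_imp_le adj_bounds[OF assms(1)] in auto)

section \<open>Orthogonality and the orthomodular law\<close>

lemma orthogonal_iff: "orthogonal L x y \<longleftrightarrow> x \<preceq> compl y"
  by (simp add: orthogonal_def)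

lemma orthogonalE:
  assumes "orthogonal L x y" "x \<le> 2 * n + 1" "y \<le> 2 * n + 1"
  obtains "x = 0" | "y = 0" | "y = compl x" | "adj x y"
  using assms by (auto simp: orthogonal_iff le_compl_iff)

lemma orthogonal_lub:
  assumes "orthogonal L x y" "x \<le> 2 * n + 1" "y \<le> 2 * n + 1"
  shows "\<exists>j. is_lub L j {x, y}"
  using assms
proof (cases rule: orthogonalE)
  case 4
  then show ?thesis
    using third_exists lub_adj by metis
next
  case 3
  then show ?thesis
    using assms lub_compl by blast
qed (use assms lub_zero in auto)

text \<open>By De Morgan the meet is the complement of the join of \<open>compl y\<close> and
  \<open>x\<close>. These are orthogonal, so the four kinds of orthogonal pairs settle the
  law.\<close>

lemma orthomodular_law:
  assumes "x \<le> 2 * n + 1" "y \<le> 2 * n + 1" "x \<preceq> y"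
  shows "y = join L x (meet L y (compl x))"
proof -
  have meet: "meet L y (compl x) = compl j" if "is_lub L j {compl y, x}" for j
    using lub_imp_glb[OF that] assms by (auto intro: meet_eqI)
  have "orthogonal L x (compl y)" "x \<le> 2 * n + 1" "compl y \<le> 2 * n + 1"
    using assms by (simp_all add: orthogonal_iff)
  then show ?thesis
  proof (cases rule: orthogonalE)
    case 1
    have "meet L y (compl x) = y"
      using meet[of "compl y"] lub_zero(2)[of "compl y"] 1 assms by simp
    then show ?thesis
      using join_eqI[OF lub_zero(1)] 1 assms by simp
  next
    case 2
    then have "y = 2 * n + 1"
      using assms by simp
    then show ?thesis
      using meet[of x] join_eqI[OF lub_compl[OF assms(1)]] lub_zero(1)[of x] assms by simp
  next
    case 3
    then have "y = x"
      using assms point_compl_eq_iff[of y n "compl x"] by simp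
    then show ?thesis
      using meet[of "2 * n + 1"] join_eqI[OF lub_zero(2)] lub_compl[of "compl y"] assms by simp
  next
    case 4
    \<comment> \<open>In the block formed by \<open>x\<close>, \<open>compl y\<close> and
      \<open>c\<close>, the meet is \<open>c\<close>, and the join of \<open>x\<close> with
      \<open>c\<close> is the complement of the remaining point.\<close>
    then obtain c where c: "adj x c" "adj (compl y) c"
      using third_exists by blast
    have "meet L y (compl x) = c"
      using meet[OF lub_adj[OF adj_sym[OF 4] c(2) c(1)]] adj_bounds[OF c(1)] by simp
    moreover have "join L x c = y"
      using join_eqI[OF lub_adj[OF c(1) 4 adj_sym[OF c(2)]]] assms by simp
    ultimately show ?thesis
      by simp
  qed
qed

sublocale orthomodular_poset L
proof
  fix x assume "x \<in> carrier L"
  then have x: "x \<le> 2 * n + 1"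
    by simp
  show "is_lub L \<top>\<^bsub>L\<^esub> {x, ocompl\<^bsub>L\<^esub> x}"
    using lub_compl[OF x] by simp
  show "is_glb L \<bottom>\<^bsub>L\<^esub> {x, ocompl\<^bsub>L\<^esub> x}"
    using lub_imp_glb[OF lub_compl[OF x]] x by (simp add: insert_commute)
qed (use compl_le orthogonal_lub orthomodular_law in auto)

section \<open>Atoms and blocks\<close>

lemma has_neighbour: "a \<in> {1..n} \<Longrightarrow> \<exists>b. adj a b"
  using degree[of a] by (metis card.empty empty_Collect_eq zero_neq_numeral)

lemma atoms_eq: "atoms L = {1..n}"
proof (intro equalityI subsetI)
  fix a assume "a \<in> {1..n}"
  then show "a \<in> atoms L"
    by (auto simp: atoms_def elim: leE)
next
  fix a assume a: "a \<in> atoms L"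
  then have bounds: "0 < a" "a \<le> 2 * n + 1"
    and minimal: "\<And>x. x \<le> 2 * n + 1 \<Longrightarrow> x \<preceq> a \<Longrightarrow> x = 0 \<or> x = a"
    by (auto simp: atoms_def)
  show "a \<in> {1..n}"
  proof (rule ccontr)
    assume "a \<notin> {1..n}"
    then have "n < a"
      using bounds by simp
    \<comment> \<open>A point below \<open>a\<close>: any point if \<open>a\<close> is the top,
      otherwise a neighbour of the complement of \<open>a\<close>.\<close>
    obtain b where "b \<preceq> a" "b \<in> {1..n}"
    proof (cases "a = 2 * n + 1")
      case True
      then show ?thesis
        using that[of 1] n_pos by simp
    next
      case False
      then have "compl a \<in> {1..n}"
        using bounds \<open>n < a\<close> point_compl_bounds(1)[of n a] by auto
      then obtain b where "adj b (compl a)"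
        using has_neighbour adj_sym by blast
      then show ?thesis
        using that[of b] adj_imp_le[of b "compl a"] adj_range[of b] bounds by simp
    qed
    then show False
      using minimal[of b] \<open>n < a\<close> by auto
  qed
qed

lemma orthogonal_atoms_iff:
  "a \<in> {1..n} \<Longrightarrow> b \<in> {1..n} \<Longrightarrow> orthogonal L a b \<longleftrightarrow> adj a b"
  by (auto simp: orthogonal_iff le_compl_iff)

lemma orthogonal_atom_sets_eq:
  "orthogonal_atom_sets L = {B. B \<subseteq> {1..n} \<and> pairwise adj B}"
  unfolding orthogonal_atom_sets_def atoms_eq pairwise_def
  using orthogonal_atoms_iff by blast

text \<open>Maximality is uniqueness of the third point: no other atom is orthogonal to both
  \<open>a\<close> and \<open>b\<close>.\<close>

lemma triangle_is_block:
  assumes "adj a b" "adj a c" "adj b c"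
  shows "{a, b, c} \<in> blocks L"
proof -
  have "{a, b, c} \<in> orthogonal_atom_sets L"
    using adj_bounds[OF assms(1)] adj_bounds[OF assms(2)] assms adj_sym
    by (auto simp: orthogonal_atom_sets_eq pairwise_def)
  moreover have "C \<subseteq> {a, b, c}" if "C \<in> orthogonal_atom_sets L" "{a, b, c} \<subseteq> C" for C
  proof
    fix x assume "x \<in> C"
    then have "x = a \<or> x = b \<or> adj a x \<and> adj b x"
      using that by (auto simp: orthogonal_atom_sets_eq pairwise_def)
    then show "x \<in> {a, b, c}"
      using third_exists[OF assms(1)] assms by blast
  qed
  ultimately show ?thesis
    by (auto simp: blocks_def)
qed

text \<open>Every clique through \<open>a\<close> lies in a triangle, which is itself a clique, so a
  maximal one equals it.\<close>

lemma block_is_triangle: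
  assumes "B \<in> blocks L" "a \<in> B"
  obtains b c where "B = {a, b, c}" "adj a b" "adj a c" "adj b c"
proof -
  have B: "B \<subseteq> {1..n}" "pairwise adj B"
    and maximal: "\<And>C. C \<in> orthogonal_atom_sets L \<Longrightarrow> B \<subseteq> C \<Longrightarrow> C = B"
    using assms by (auto simp: blocks_def orthogonal_atom_sets_eq)
  \<comment> \<open>If \<open>B\<close> were just \<open>{a}\<close>, any neighbour would do:
    \<open>B\<close> still lies in the resulting triangle.\<close>
  obtain b where b: "adj a b" "B \<noteq> {a} \<Longrightarrow> b \<in> B"
  proof (cases "B = {a}")
    case True
    then show ?thesis
      using has_neighbour[of a] B assms(2) that by auto
  next
    case False
    then obtain b where "b \<in> B" "b \<noteq> a"
      using assms(2) by blast
    then show ?thesis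
      using B(2) assms(2) that[of b] by (auto simp: pairwise_def)
  qed
  obtain c where c: "adj a c" "adj b c" "\<And>x. adj a x \<Longrightarrow> adj b x \<Longrightarrow> x = c"
    using third_exists[OF b(1)] by metis
  have "B \<subseteq> {a, b, c}"
  proof
    fix x assume "x \<in> B"
    show "x \<in> {a, b, c}"
    proof (cases "x = a \<or> x = b")
      case False
      then have "b \<in> B"
        using b(2) \<open>x \<in> B\<close> by blast
      then have "adj a x" "adj b x"
        using B(2) assms(2) False \<open>x \<in> B\<close> by (auto simp: pairwise_def)
      then show ?thesis
        using c(3) by blast
    qed blast
  qed
  moreover have "{a, b, c} \<in> orthogonal_atom_sets L"
    using triangle_is_block[OF b(1) c(1,2)] by (simp add: blocks_def)
  ultimately have "B = {a, b, c}"
    using maximal by blast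
  then show thesis
    using that b(1) c(1,2) by blast
qed

lemma card_block:
  assumes "B \<in> blocks L"
  shows "card B = 3"
proof -
  \<comment> \<open>The empty clique has to be ruled out first: it is not maximal because some block
    exists.\<close>
  obtain a b where "adj a b"
    using has_neighbour[of 1] n_pos by auto
  then obtain c where "adj a c" "adj b c"
    using third_exists by blast
  then have "{a, b, c} \<in> blocks L"
    using triangle_is_block[OF \<open>adj a b\<close>] by blast
  then have "B \<noteq> {}"
    using assms by (auto simp: blocks_def)
  then obtain a b c where abc: "B = {a, b, c}" "adj a b" "adj a c" "adj b c"
    using block_is_triangle[OF assms] by blast
  then show ?thesis
    using adj_bounds(5)[OF abc(2)] adj_bounds(5)[OF abc(3)] adj_bounds(5)[OF abc(4)] by simp
qed

text \<open>The blocks through \<open>a\<close> split the six neighbours of \<open>a\<close> into pairs.\<close>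

lemma card_blocks_through:
  assumes "a \<in> {1..n}"
  shows "card {B \<in> blocks L. a \<in> B} = 3"
proof -
  define P where "P = (\<lambda>B. B - {a}) ` {B \<in> blocks L. a \<in> B}"
  have sub: "blocks L \<subseteq> Pow {1..n}"
    by (auto simp: blocks_def orthogonal_atom_sets_eq)
  have fin: "finite P"
    unfolding P_def using finite_subset[OF sub] by simp
  have Union: "\<Union>P = {b. adj a b}"
  proof (intro equalityI subsetI)
    fix x assume "x \<in> \<Union>P"
    then obtain B where "B \<in> blocks L" "a \<in> B" "x \<in> B" "x \<noteq> a"
      by (auto simp: P_def)
    then show "x \<in> {b. adj a b}"
      by (auto simp: blocks_def orthogonal_atom_sets_eq pairwise_def)
  next
    fix b assume "b \<in> {b. adj a b}"
    then have b: "adj a b"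
      by simp
    then obtain c where "adj a c" "adj b c"
      using third_exists by blast
    then have "{a, b, c} - {a} \<in> P"
      unfolding P_def using triangle_is_block[OF b] by blast
    then show "b \<in> \<Union>P"
      using adj_irrefl b by blast
  qed
  have card2: "card C = 2" if "C \<in> P" for C
    using that card_block by (auto simp: P_def)
  have disjoint: "C = D" if CD: "C \<in> P" "D \<in> P" "C \<inter> D \<noteq> {}" for C D
  proof -
    obtain x where x: "x \<in> C" "x \<in> D"
      using CD(3) by blast
    \<comment> \<open>A member of \<open>P\<close> is determined by any of its points
      \<open>x\<close>: the other one is the third point on the block through \<open>a\<close> and
      \<open>x\<close>. Overlapping members therefore coincide.\<close>
    have "C = {y. y = x \<or> adj a y \<and> adj x y}" if C: "C \<in> P" "x \<in> C" for C
    proof -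
      obtain B where B: "B \<in> blocks L" "a \<in> B" "x \<in> B" "x \<noteq> a" "C = B - {a}"
        using C by (auto simp: P_def)
      have pw: "pairwise adj B"
        using B(1) by (simp add: blocks_def orthogonal_atom_sets_eq)
      then have "adj a x"
        using B by (auto simp: pairwise_def)
      obtain b c where "B = {a, b, c}" "adj a b" "adj a c" "adj b c"
        using block_is_triangle[OF B(1,2)] .
      then obtain z where z: "B = {a, x, z}" "adj a z" "adj x z"
        using B(3,4) adj_sym by (cases "x = b") auto
      have "y = z" if "adj a y" "adj x y" for y
        using third_exists[OF \<open>adj a x\<close>] that z by metis
      then have "{y. y = x \<or> adj a y \<and> adj x y} = {x, z}"
        using z(2,3) by blast
      moreover have "C = {x, z}"
        using B(4,5) z(1) adj_bounds(5)[OF z(2)] by auto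
      ultimately show ?thesis
        by simp
    qed
    then show ?thesis
      using x CD by blast
  qed
  have "card {b. adj a b} = (\<Sum>C\<in>P. card C)"
    unfolding Union[symmetric]
    by (rule card_Union_disjoint) (use disjoint card2 in \<open>auto simp: pairwise_def disjnt_def card_ge_0_finite\<close>)
  also have "\<dots> = 2 * card P"
    using card2 by simp
  finally have "card P = 3"
    using degree[OF assms] by simp
  moreover have "card P = card {B \<in> blocks L. a \<in> B}"
    unfolding P_def by (rule card_image) (auto simp: inj_on_def)
  ultimately show ?thesis
    by simp
qed

lemma homogeneous_L: "homogeneous 3 3 L"
  using card_blocks_through card_block by (simp add: homogeneous_def atoms_eq)

section \<open>States\<close>

definition weight :: "(nat \<Rightarrow> real) \<Rightarrow> bool"
  where "weight w \<longleftrightarrow> (\<forall>a\<in>{1..n}. 0 \<le> w a) \<and>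
    (\<forall>a b c. adj a b \<longrightarrow> adj a c \<longrightarrow> adj b c \<longrightarrow> w a + w b + w c = 1)"

text \<open>Additivity forces the values on the bounds and on the complements. The restricted
  abstraction makes the function extensional, as \<open>states\<close> demands.\<close>

definition state_of :: "(nat \<Rightarrow> real) \<Rightarrow> nat \<Rightarrow> real"
  where "state_of w = (\<lambda>x\<in>{0..2 * n + 1}. if x = 0 then 0 else if x \<le> n then w x
    else if x \<le> 2 * n then 1 - w (compl x) else 1)"

lemma weight_nonneg: "weight w \<Longrightarrow> a \<in> {1..n} \<Longrightarrow> 0 \<le> w a"
  by (simp add: weight_def)

lemma weight_triangle: "weight w \<Longrightarrow> adj a b \<Longrightarrow> adj a c \<Longrightarrow> adj b c \<Longrightarrow> w a + w b + w c = 1"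
  by (simp add: weight_def)

lemma triangle_through:
  assumes "a \<in> {1..n}"
  obtains b c where "adj a b" "adj a c" "adj b c" "b \<in> {1..n}" "c \<in> {1..n}"
proof -
  obtain b where "adj a b"
    using has_neighbour[OF assms] by blast
  moreover from this obtain c where "adj a c" "adj b c"
    using third_exists by blast
  ultimately show thesis
    using that[of b c] adj_range[of b c] adj_range[OF adj_sym[of b c]] by blast
qed

lemma weight_le_1:
  assumes "weight w" "a \<in> {1..n}"
  shows "w a \<le> 1"
proof -
  obtain b c where bc: "adj a b" "adj a c" "adj b c" "b \<in> {1..n}" "c \<in> {1..n}"
    using triangle_through[OF assms(2)] .
  then show ?thesis
    using weight_triangle[OF assms(1) bc(1-3)] weight_nonneg[OF assms(1) bc(4)]
      weight_nonneg[OF assms(1) bc(5)] by simp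
qed

lemma state_of_simps:
  "state_of w 0 = 0"
  "a \<in> {1..n} \<Longrightarrow> state_of w a = w a"
  "a \<in> {1..n} \<Longrightarrow> state_of w (compl a) = 1 - w a"
  "state_of w (2 * n + 1) = 1"
  using point_compl_bounds[of n a] by (auto simp: state_of_def)

lemma carrier_cases:
  assumes "x \<le> 2 * n + 1"
  obtains "x = 0" | "x \<in> {1..n}" | a where "x = compl a" "a \<in> {1..n}" | "x = 2 * n + 1"
proof -
  have "x = compl (compl x) \<and> compl x \<in> {1..n}" if "n < x" "x \<noteq> 2 * n + 1"
    using assms that point_compl_bounds(1)[of n x] by auto
  then show thesis
    using assms that(1,2,4) that(3)[of "compl x"] by (cases "x \<le> n") (auto simp: Suc_le_eq)
qed

text \<open>For adjacent points the join is the complement of the third point \<open>c\<close>, so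
  additivity is the equation \<open>w x + w y = 1 - w c\<close> of their block; the other orthogonal
  pairs involve 0 or are complementary.\<close>

lemma state_of_additive:
  assumes "weight w" "x \<le> 2 * n + 1" "y \<le> 2 * n + 1" "orthogonal L x y"
  shows "state_of w (join L x y) = state_of w x + state_of w y"
  using assms(4,2,3)
proof (cases rule: orthogonalE)
  case 1
  then show ?thesis
    using join_eqI[OF lub_zero(1)] assms by (simp add: state_of_simps)
next
  case 2
  then show ?thesis
    using join_eqI[OF lub_zero(2)] assms by (simp add: state_of_simps)
next
  case 3
  have "state_of w x + state_of w (compl x) = 1"
    using assms(2) by (cases rule: carrier_cases) (use state_of_simps in auto)
  then show ?thesis
    using join_eqI[OF lub_compl[OF assms(2)]] 3 state_of_simps(4) by simp
next
  case 4
  then obtain c where c: "adj x c" "adj y c"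
    using third_exists by blast
  then have "x \<in> {1..n}" "y \<in> {1..n}" "c \<in> {1..n}"
    using adj_range[OF 4] adj_range[OF c(2)] adj_range[OF adj_sym[OF c(2)]] by simp_all
  then show ?thesis
    using join_eqI[OF lub_adj[OF 4 c]] weight_triangle[OF assms(1) 4 c]
    by (simp add: state_of_simps)
qed

lemma state_of_in_states:
  assumes "weight w"
  shows "state_of w \<in> states L"
proof -
  have range: "state_of w x \<in> {0..1}" if "x \<le> 2 * n + 1" for x
    using that
    by (cases rule: carrier_cases)
      (auto simp: state_of_simps[simplified] weight_nonneg[OF assms] weight_le_1[OF assms])
  have "state_of w \<in> carrier L \<rightarrow>\<^sub>E {0..1}"
  proof (rule PiE_I)
    show "state_of w x \<in> {0..1}" if "x \<in> carrier L" for x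
      using that range by simp
  qed (simp add: state_of_def)
  then show ?thesis
    using state_of_additive[OF assms] state_of_simps(4)[of w] by (simp add: states_def)
qed

section \<open>From states back to weights\<close>

lemma state_compl:
  assumes "s \<in> states L" "x \<le> 2 * n + 1"
  shows "s (compl x) = 1 - s x"
proof -
  have "orthogonal L x (compl x)"
    using assms(2) by (simp add: orthogonal_iff)
  then have "s (join L x (compl x)) = s x + s (compl x)"
    using assms by (simp add: states_def)
  moreover have "s (2 * n + 1) = 1"
    using assms(1) by (simp add: states_def)
  ultimately show ?thesis
    using join_eqI[OF lub_compl[OF assms(2)]] by simp
qed

text \<open>The join of two points of a block is the complement of the third, so additivity and the
  rule for complements give the block equation.\<close>

lemma weight_of_state:
  assumes "s \<in> states L"
  shows "weight s"
  unfolding weight_def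
proof (intro conjI ballI allI impI)
  fix a assume "a \<in> {1..n}"
  then show "0 \<le> s a"
    using assms by (auto simp: states_def PiE_iff)
next
  fix a b c assume abc: "adj a b" "adj a c" "adj b c"
  then have bounds: "a \<le> 2 * n + 1" "b \<le> 2 * n + 1" "c \<le> 2 * n + 1"
    using adj_bounds[OF abc(1)] adj_bounds[OF abc(2)] by simp_all
  have "orthogonal L a b"
    using adj_imp_le[OF abc(1)] by (simp add: orthogonal_iff)
  then have "s (join L a b) = s a + s b"
    using assms bounds by (simp add: states_def)
  then show "s a + s b + s c = 1"
    using join_eqI[OF lub_adj[OF abc]] state_compl[OF assms bounds(3)] by simp
qed

text \<open>The values on the atoms fix those on complements, and the bounds have fixed values;
  outside the carrier both functions are \<open>undefined\<close>.\<close>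

lemma state_eqI:
  assumes "s \<in> states L" "t \<in> states L" "\<And>a. a \<in> {1..n} \<Longrightarrow> s a = t a"
  shows "s = t"
proof
  fix x
  show "s x = t x"
  proof (cases "x \<le> 2 * n + 1")
    case True
    have 0: "r (2 * n + 1) = 1" "r 0 = 0" if "r \<in> states L" for r
      using that state_compl[OF that, of "2 * n + 1"] by (auto simp: states_def)
    show ?thesis
      using True
    proof (cases rule: carrier_cases)
      case (3 a)
      then have "a \<le> 2 * n + 1"
        by simp
      then show ?thesis
        using state_compl[OF assms(1)] state_compl[OF assms(2)] assms(3)[OF 3(2)] 3(1) by simp
    qed (use assms(3) 0[OF assms(1)] 0[OF assms(2)] in auto)
  next
    case False
    then show ?thesis
      using assms(1,2) by (simp add: states_def PiE_def extensional_def)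
  qed
qed

lemma state_of_weight:
  assumes "s \<in> states L" "\<And>a. a \<in> {1..n} \<Longrightarrow> s a = w a"
  shows "s = state_of w"
proof -
  have "weight w"
    unfolding weight_def
  proof (intro conjI ballI allI impI)
    show "0 \<le> w a" if "a \<in> {1..n}" for a
      using weight_nonneg[OF weight_of_state[OF assms(1)] that] assms(2)[OF that] by simp
    show "w a + w b + w c = 1" if "adj a b" "adj a c" "adj b c" for a b c
      using weight_triangle[OF weight_of_state[OF assms(1)] that] assms(2) that
        adj_range[OF that(1)] adj_range[OF that(3)] adj_range[OF adj_sym[OF that(3)]] by simp
  qed
  then show ?thesis
    using state_eqI[OF assms(1) state_of_in_states] assms(2) by (simp add: state_of_simps)
qed

section \<open>Pure states\<close>

text \<open>Start at \<open>u\<close> and move away from \<open>w\<close> until some positive weight reaches zero.\<close>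

lemma push_away:
  assumes u: "weight u" and w: "weight w" and "\<exists>a\<in>{1..n}. u a \<noteq> w a"
    and supp: "\<And>a. a \<in> {1..n} \<Longrightarrow> u a = 0 \<Longrightarrow> w a = 0"
  obtains t j where "0 < t" "weight (\<lambda>a. u a + t * (u a - w a))"
    "j \<in> {1..n}" "u j \<noteq> 0" "u j + t * (u j - w j) = 0"
proof -
  \<comment> \<open>The points whose weight decreases when moving away from
    \<open>w\<close>.\<close>
  define D where "D = {a \<in> {1..n}. u a < w a}"
  have "D \<noteq> {}"
  proof -
    obtain a where a: "a \<in> {1..n}" "u a \<noteq> w a"
      using assms(3) by blast
    obtain b c where abc: "adj a b" "adj a c" "adj b c" "b \<in> {1..n}" "c \<in> {1..n}"
      using triangle_through[OF a(1)] .
    \<comment> \<open>Both weights sum to one on a block through \<open>a\<close>, so a difference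
      at \<open>a\<close> forces some coordinate of the block to be smaller in
      \<open>u\<close>.\<close>
    have "u a + u b + u c = w a + w b + w c"
      using weight_triangle[OF u abc(1-3)] weight_triangle[OF w abc(1-3)] by simp
    then have "u a < w a \<or> u b < w b \<or> u c < w c"
      using a(2) by linarith
    then show ?thesis
      using a(1) abc by (auto simp: D_def)
  qed
  moreover have "finite D"
    by (simp add: D_def)
  ultimately obtain j where j: "j \<in> D"
    and min: "\<And>a. a \<in> D \<Longrightarrow> u j / (w j - u j) \<le> u a / (w a - u a)"
    using ex_min_if_finite[of "(\<lambda>a. u a / (w a - u a)) ` D"] by (auto simp: not_less)
  \<comment> \<open>The ratio test: the largest step that keeps all weights nonnegative, attained at
    \<open>j\<close>.\<close>
  define t where "t = u j / (w j - u j)"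
  have j': "j \<in> {1..n}" "u j < w j" "0 \<le> u j"
    using j weight_nonneg[OF u] by (auto simp: D_def)
  \<comment> \<open>Here the support condition enters: \<open>u j = 0\<close> would give
    \<open>w j = 0\<close>, contrary to \<open>u j < w j\<close>. So the step is positive.\<close>
  then have "u j \<noteq> 0"
    using supp[of j] by auto
  then have "0 < t"
    using j' by (simp add: t_def)
  moreover have "weight (\<lambda>a. u a + t * (u a - w a))"
    unfolding weight_def
  proof (intro conjI ballI allI impI)
    fix a assume a: "a \<in> {1..n}"
    show "0 \<le> u a + t * (u a - w a)"
    proof (cases "u a < w a")
      case True
      then have "t \<le> u a / (w a - u a)"
        using min[of a] a by (simp add: D_def t_def)
      then have "t * (w a - u a) \<le> u a"
        using True by (simp add: pos_le_divide_eq)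
      then show ?thesis
        by (simp add: algebra_simps)
    next
      case False
      then show ?thesis
        using \<open>0 < t\<close> weight_nonneg[OF u a] by simp
    qed
  next
    fix a b c assume abc: "adj a b" "adj a c" "adj b c"
    have "u a + t * (u a - w a) + (u b + t * (u b - w b)) + (u c + t * (u c - w c)) =
        (u a + u b + u c) + t * ((u a + u b + u c) - (w a + w b + w c))"
      by (simp add: algebra_simps)
    then show "u a + t * (u a - w a) + (u b + t * (u b - w b)) + (u c + t * (u c - w c)) = 1"
      using weight_triangle[OF u abc] weight_triangle[OF w abc] by simp
  qed
  moreover have "u j + t * (u j - w j) = 0"
    using j' by (simp add: t_def field_simps)
  ultimately show thesis
    using that j'(1) \<open>u j \<noteq> 0\<close> by blast
qed

text \<open>
  Extreme points of the polytope of weights are the weights of minimal support, so a list of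
  weights exhausts them if the supports form an antichain lying below every other support.
\<close>

theorem pure_states_eq:
  assumes weights: "\<And>v. v \<in> V \<Longrightarrow> weight v"
    and antichain: "\<And>v w. v \<in> V \<Longrightarrow> w \<in> V \<Longrightarrow> v \<noteq> w \<Longrightarrow> \<exists>a\<in>{1..n}. v a = 0 \<and> w a \<noteq> 0"
    and cover: "\<And>w. weight w \<Longrightarrow> \<exists>v\<in>V. \<forall>a\<in>{1..n}. w a = 0 \<longrightarrow> v a = 0"
  shows "pure_states L = state_of ` V"
proof (intro equalityI subsetI)
  fix s assume s: "s \<in> pure_states L"
  then have st: "s \<in> states L"
    by (simp add: pure_states_def)
  \<comment> \<open>The support of \<open>v\<close> lies in that of \<open>s\<close>. If they
    differed, pushing \<open>s\<close> away from \<open>v\<close> would put \<open>s\<close>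
    strictly between two states.\<close>
  obtain v where v: "v \<in> V" "\<And>a. a \<in> {1..n} \<Longrightarrow> s a = 0 \<Longrightarrow> v a = 0"
    using cover[OF weight_of_state[OF st]] by blast
  have "s a = v a" if "a \<in> {1..n}" for a
  proof (rule ccontr)
    assume "s a \<noteq> v a"
    then obtain t where t: "0 < t" "weight (\<lambda>a. s a + t * (s a - v a))"
      using push_away[OF weight_of_state[OF st] weights[OF v(1)] _ v(2)] \<open>a \<in> {1..n}\<close> by metis
    define r where "r = state_of (\<lambda>a. s a + t * (s a - v a))"
    have states: "r \<in> states L" "state_of v \<in> states L"
      using state_of_in_states t(2) weights v(1) by (auto simp: r_def)
    have atom: "r b = s b + t * (s b - v b)" "state_of v b = v b" if "b \<in> {1..n}" for b
      using that by (simp_all add: r_def state_of_simps)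
    have "r \<noteq> state_of v"
    proof
      assume "r = state_of v"
      then have "(1 + t) * (s a - v a) = 0"
        using atom[OF \<open>a \<in> {1..n}\<close>] by (simp add: algebra_simps)
      then show False
        using t(1) \<open>s a \<noteq> v a\<close> by simp
    qed
    \<comment> \<open>Solving \<open>r = s + t * (s - v)\<close> for \<open>s\<close> gives
      \<open>s = (r + t * v) / (1 + t)\<close>.\<close>
    define q where "q = t / (1 + t)"
    have q: "0 < q" "q < 1" and q': "1 - q = 1 / (1 + t)"
      using t(1) by (auto simp: q_def field_simps)
    have "s x = (1 - q) * r x + q * state_of v x" if "x \<le> 2 * n + 1" for x
    proof -
      have b: "s b = (1 - q) * r b + q * state_of v b" if "b \<in> {1..n}" for b
      proof -
        have "(1 - q) * r b + q * state_of v b = (s b + t * (s b - v b) + t * v b) / (1 + t)"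
          by (simp add: atom[OF that] q' add_divide_distrib) (simp add: q_def)
        also have "s b + t * (s b - v b) + t * v b = (1 + t) * s b"
          by (simp add: algebra_simps)
        finally show ?thesis
          using t(1) by simp
      qed
      have zero: "p 0 = 0" and one: "p (2 * n + 1) = 1" if "p \<in> states L" for p
        using state_compl[OF that, of "2 * n + 1"] that by (auto simp: states_def)
      show ?thesis
        using that
      proof (cases rule: carrier_cases)
        case (3 b)
        then have "b \<le> 2 * n + 1"
          by simp
        then have eq: "s x = 1 - s b" "r x = 1 - r b" "state_of v x = 1 - state_of v b"
          using 3(1) state_compl st states by auto
        have "(1 - q) * r x + q * state_of v x = 1 - ((1 - q) * r b + q * state_of v b)"
          unfolding eq by (simp add: algebra_simps)
        then show ?thesis
          using b[OF 3(2)] eq(1) by simp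
      qed (use b zero[OF st] zero[OF states(1)] zero[OF states(2)] one[OF st] one[OF states(1)]
          one[OF states(2)] in auto)
    qed
    then have "\<forall>x\<in>carrier L. s x = (1 - q) * r x + q * state_of v x"
      by simp
    then show False
      using s states \<open>r \<noteq> state_of v\<close> q unfolding pure_states_def by blast
  qed
  then have "s = state_of v"
    using state_of_weight[OF st] by blast
  then show "s \<in> state_of ` V"
    using v(1) by blast
next
  fix s assume "s \<in> state_of ` V"
  then obtain v where v: "v \<in> V" "s = state_of v"
    by blast
  have "False" if s12: "s1 \<in> states L" "s2 \<in> states L" "s1 \<noteq> s2" and q: "0 < q" "q < 1"
    and comb: "\<forall>x\<in>carrier L. s x = (1 - q) * s1 x + q * s2 x" for s1 s2 and q :: real
  proof -
    have vcomb: "v a = (1 - q) * s1 a + q * s2 a" if "a \<in> {1..n}" for a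
    proof -
      have "a \<in> carrier L"
        using that by simp
      then show ?thesis
        using comb v(2) state_of_simps(2)[OF that] by metis
    qed
    \<comment> \<open>A proper convex combination of nonnegative numbers vanishes only if both do,
      so both supports lie in that of \<open>v\<close>.\<close>
    have "s1 a = 0 \<and> s2 a = 0" if "a \<in> {1..n}" "v a = 0" for a
    proof -
      have "0 \<le> s1 a" "0 \<le> s2 a"
        using weight_nonneg weight_of_state s12 that by blast+
      moreover have "(1 - q) * s1 a + q * s2 a = 0"
        using vcomb that by simp
      ultimately show ?thesis
        using q by (simp add: add_nonneg_eq_0_iff)
    qed
    moreover have "\<exists>r\<in>{s1, s2}. \<exists>a\<in>{1..n}. v a \<noteq> r a"
      using state_eqI[OF s12(1,2)] s12(3) by (metis insertCI)
    ultimately obtain r where r: "r \<in> states L" "\<exists>a\<in>{1..n}. v a \<noteq> r a"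
        "\<And>a. a \<in> {1..n} \<Longrightarrow> v a = 0 \<Longrightarrow> r a = 0"
      using s12 by blast
    \<comment> \<open>Pushing \<open>v\<close> away from \<open>r\<close> removes \<open>j\<close>
      from the support and adds nothing. A member of \<open>V\<close> below the new support then
      contradicts the antichain condition.\<close>
    obtain t j where "0 < t" and t: "weight (\<lambda>a. v a + t * (v a - r a))"
        "j \<in> {1..n}" "v j \<noteq> 0" "v j + t * (v j - r j) = 0"
      by (rule push_away[OF weights[OF v(1)] weight_of_state[OF r(1)] r(2)]) (blast intro: r(3))+
    obtain w where w: "w \<in> V" "\<And>a. a \<in> {1..n} \<Longrightarrow> v a + t * (v a - r a) = 0 \<Longrightarrow> w a = 0"
      using cover[OF t(1)] by blast
    have "w j = 0"
      using w(2) t by blast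
    then have "v \<noteq> w"
      using t(3) by blast
    then obtain a where "a \<in> {1..n}" "v a = 0" "w a \<noteq> 0"
      using antichain[OF v(1) w(1)] by blast
    then show False
      using w(2)[of a] r(3)[of a] by simp
  qed
  then show "s \<in> pure_states L"
    using state_of_in_states[OF weights[OF v(1)]] v(2) unfolding pure_states_def by blast
qed

end

section \<open>Realization from a block list and a vertex table\<close>

definition collinear :: "nat list list \<Rightarrow> nat \<Rightarrow> nat \<Rightarrow> bool"
  where "collinear bs a b \<longleftrightarrow> a \<noteq> b \<and> (\<exists>B\<in>set bs. a \<in> set B \<and> b \<in> set B)"

definition neighbours :: "nat list list \<Rightarrow> nat \<Rightarrow> nat list"
  where "neighbours bs a = concat (map (removeAll a) (filter (\<lambda>B. a \<in> set B) bs))"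

text \<open>An executable criterion. \<open>neighbours\<close> keeps multiplicities, so distinctness
  says that two blocks through a point share nothing else, and length six means three blocks through
  it. The last clause forbids common neighbours of two points of a block outside that block, hence
  triangles of lines.\<close>

definition configuration :: "nat \<Rightarrow> nat list list \<Rightarrow> bool"
  where "configuration n bs \<longleftrightarrow> 0 < n \<and>
    (\<forall>B\<in>set bs. length B = 3 \<and> distinct B \<and> (\<forall>a\<in>set B. 1 \<le> a \<and> a \<le> n)) \<and>
    (\<forall>a\<in>set [1..<Suc n]. distinct (neighbours bs a) \<and> length (neighbours bs a) = 6) \<and>
    (\<forall>B\<in>set bs. distinct (concat (map (\<lambda>a. filter (\<lambda>x. x \<notin> set B) (neighbours bs a)) B)))"

text \<open>The entry of \<open>v\<close> at position \<open>a - 1\<close>, divided by \<open>d\<close>, is the weight of the point \<open>a\<close>.\<close>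

definition vertex_table :: "nat \<Rightarrow> nat list list \<Rightarrow> nat \<Rightarrow> nat list list \<Rightarrow> bool"
  where "vertex_table n bs d vs \<longleftrightarrow> 0 < d \<and> distinct vs \<and>
    (\<forall>v\<in>set vs. \<forall>B\<in>set bs. sum_list (map (\<lambda>a. v ! (a - 1)) B) = d) \<and>
    (\<forall>v\<in>set vs. \<forall>w\<in>set vs. v \<noteq> w \<longrightarrow>
      (\<exists>a\<in>set [1..<Suc n]. v ! (a - 1) = 0 \<and> w ! (a - 1) \<noteq> 0))"

definition realizable :: "nat \<Rightarrow> bool"
  where "realizable k \<longleftrightarrow> (\<exists>L :: nat ortho_poset. orthomodular_poset L \<and> finite (carrier L) \<and>
    homogeneous 3 3 L \<and> card (atoms L) \<le> 19 \<and> card (pure_states L) = k)"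

section \<open>From block lists to triangle graphs\<close>

lemma set_neighbours: "set (neighbours bs a) = {b. collinear bs a b}"
  by (auto simp: neighbours_def collinear_def)

lemma distinct_concat_map_disjoint:
  "distinct (concat (map f xs)) \<Longrightarrow> a \<in> set xs \<Longrightarrow> b \<in> set xs \<Longrightarrow> a \<noteq> b \<Longrightarrow> set (f a) \<inter> set (f b) = {}"
  by (induction xs) auto

lemma conf_block_third:
  assumes "configuration n bs" "B \<in> set bs" "a \<in> set B" "b \<in> set B" "a \<noteq> b"
  shows "\<exists>c. set B - {a, b} = {c}"
proof -
  have "distinct B" "length B = 3"
    using assms by (auto simp: configuration_def)
  then have "card (set B - {a, b}) = 1"
    using assms distinct_card[of B] by (simp add: card_Diff_subset)
  then show ?thesis
    by (simp add: card_1_singleton_iff)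
qed

lemma triangle_graph_collinear:
  assumes "configuration n bs"
  shows "triangle_graph n (collinear bs)"
proof
  show "0 < n"
    using assms by (simp add: configuration_def)
  show "a \<in> {1..n}" if "collinear bs a b" for a b
    using assms that by (auto simp: configuration_def collinear_def)
  show "collinear bs b a" if "collinear bs a b" for a b
    using that by (auto simp: collinear_def)
  show "\<not> collinear bs a a" for a
    by (simp add: collinear_def)
  show "card {b. collinear bs a b} = 6" if "a \<in> {1..n}" for a
  proof -
    have "a \<in> set [1..<Suc n]"
      using that by auto
    then have "distinct (neighbours bs a)" "length (neighbours bs a) = 6"
      using assms unfolding configuration_def by blast+
    then show ?thesis
      using distinct_card[of "neighbours bs a"] by (simp add: set_neighbours)
  qed
  show "\<exists>c. {x. collinear bs a x \<and> collinear bs b x} = {c}" if ab: "collinear bs a b" for a b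
  proof -
    obtain B where B: "B \<in> set bs" "a \<in> set B" "b \<in> set B" "a \<noteq> b"
      using ab by (auto simp: collinear_def)
    then obtain c where c: "set B - {a, b} = {c}"
      using conf_block_third[OF assms] by metis
    \<comment> \<open>Disjointness of these lists for \<open>a\<close> and \<open>b\<close> leaves
      only the third point of \<open>B\<close> as a common neighbour.\<close>
    define N where "N x = filter (\<lambda>y. y \<notin> set B) (neighbours bs x)" for x
    have "distinct (concat (map N B))"
      using assms B(1) unfolding configuration_def N_def by blast
    then have "set (N a) \<inter> set (N b) = {}"
      using B(2-4) by (rule distinct_concat_map_disjoint)
    then have "x \<in> set B" if "collinear bs a x" "collinear bs b x" for x
      using that by (auto simp: N_def set_neighbours)
    then have "{x. collinear bs a x \<and> collinear bs b x} = set B - {a, b}"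
      using B by (auto simp: collinear_def)
    then show ?thesis
      using c by simp
  qed
qed

text \<open>The triangles of the collinearity graph are exactly the listed blocks, so only the
  listed equations have to be considered.\<close>

lemma weight_iff_blocks:
  assumes "configuration n bs"
  shows "triangle_graph.weight n (collinear bs) w \<longleftrightarrow>
    (\<forall>a\<in>{1..n}. 0 \<le> w a) \<and> (\<forall>B\<in>set bs. sum_list (map w B) = 1)"
proof -
  interpret triangle_graph n "collinear bs"
    using triangle_graph_collinear[OF assms] .
  have "w a + w b + w c = 1"
    if sums: "\<forall>B\<in>set bs. sum_list (map w B) = 1"
      and abc: "collinear bs a b" "collinear bs a c" "collinear bs b c" for a b c
  proof -
    obtain B where B: "B \<in> set bs" "a \<in> set B" "b \<in> set B"
      using abc(1) by (auto simp: collinear_def)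
    have "distinct B"
      using assms B(1) by (simp add: configuration_def)
    obtain d where d: "set B - {a, b} = {d}"
      using conf_block_third[OF assms B] abc(1) by (auto simp: collinear_def)
    then have "collinear bs a d" "collinear bs b d"
      using B by (auto simp: collinear_def)
    then have "d = c"
      using third_exists[OF abc(1)] abc(2,3) by metis
    then have "set B = {a, b, c}"
      using d B by blast
    then have "sum_list (map w B) = sum w {a, b, c}"
      using \<open>distinct B\<close> sum_list_distinct_conv_sum_set by metis
    also have "\<dots> = w a + w b + w c"
      using abc by (simp add: collinear_def)
    finally show ?thesis
      using sums B(1) by simp
  qed
  moreover have "sum_list (map w B) = 1"
    if sums: "\<And>a b c. collinear bs a b \<Longrightarrow> collinear bs a c \<Longrightarrow> collinear bs b c \<Longrightarrow> w a + w b + w c = 1"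
      and B: "B \<in> set bs" for B
  proof -
    have B': "distinct B" "length B = 3"
      using assms B by (auto simp: configuration_def)
    then obtain a b c where abc: "B = [a, b, c]"
      by (auto simp: length_Suc_conv numeral_3_eq_3)
    then have "collinear bs a b" "collinear bs a c" "collinear bs b c"
      using B B'(1) by (auto simp: collinear_def intro!: bexI[of _ B])
    then show ?thesis
      using sums[of a b c] abc by simp
  qed
  ultimately show ?thesis
    unfolding weight_def by blast
qed

text \<open>Everything except \<open>cover\<close> is decided by evaluation. \<open>cover\<close> is
  phrased with literal lists so that simplification turns it into linear arithmetic in
  \<open>w 1\<close>, \<open>w 2\<close> and so on.\<close>

theorem realizableI:
  assumes conf: "configuration n bs" and table: "vertex_table n bs d vs"
    and "n \<le> 19" "length vs = k"
    and cover: "\<And>w :: nat \<Rightarrow> real. list_all (\<lambda>a. 0 \<le> w a) [1..<Suc n] \<Longrightarrow>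
      list_all (\<lambda>B. sum_list (map w B) = 1) bs \<Longrightarrow>
      \<exists>v\<in>set vs. list_all2 (\<lambda>a x. w a = 0 \<longrightarrow> x = 0) [1..<Suc n] v"
  shows "realizable k"
proof -
  interpret triangle_graph n "collinear bs"
    using triangle_graph_collinear[OF conf] .
  have points: "set [1..<Suc n] = {1..n}"
    by auto
  define f where "f v a = real (v ! (a - 1)) / real d" for v :: "nat list" and a
  have "0 < d"
    using table by (simp add: vertex_table_def)
  then have zero_iff: "f v a = 0 \<longleftrightarrow> v ! (a - 1) = 0" for v a
    by (simp add: f_def)
  have antichain: "\<exists>a\<in>{1..n}. f v a = 0 \<and> f w a \<noteq> 0" if "v \<in> set vs" "w \<in> set vs" "v \<noteq> w" for v w
    using table that unfolding vertex_table_def points zero_iff by blast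
  have "weight (f v)" if "v \<in> set vs" for v
    unfolding weight_iff_blocks[OF conf]
  proof (intro conjI ballI)
    show "0 \<le> f v a" for a
      by (simp add: f_def)
    fix B assume "B \<in> set bs"
    have "sum_list (map (f v) B) = real (sum_list (map (\<lambda>a. v ! (a - 1)) B)) / real d"
      by (induction B) (simp_all add: f_def add_divide_distrib)
    also have "sum_list (map (\<lambda>a. v ! (a - 1)) B) = d"
      using table that \<open>B \<in> set bs\<close> by (simp add: vertex_table_def)
    finally show "sum_list (map (f v) B) = 1"
      using \<open>0 < d\<close> by simp
  qed
  moreover have "\<exists>u\<in>f ` set vs. \<forall>a\<in>{1..n}. w a = 0 \<longrightarrow> u a = 0" if w: "weight w" for w
  proof -
    obtain v where v: "v \<in> set vs" "list_all2 (\<lambda>a x. w a = 0 \<longrightarrow> x = 0) [1..<Suc n] v"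
      using cover[of w] w unfolding weight_iff_blocks[OF conf] list_all_iff points by blast
    \<comment> \<open>Position \<open>a - 1\<close> of \<open>[1..<Suc n]\<close> holds the point
      \<open>a\<close>, in step with the indexing of the table.\<close>
    have "f v a = 0" if "a \<in> {1..n}" "w a = 0" for a
      using list_all2_nthD[OF v(2), of "a - 1"] that by (auto simp: zero_iff simp del: upt_Suc)
    then show ?thesis
      using v(1) by blast
  qed
  ultimately have "pure_states L = state_of ` f ` set vs"
    using antichain by (intro pure_states_eq) blast+
  also have "\<dots> = (\<lambda>v. state_of (f v)) ` set vs"
    by (simp add: image_image)
  \<comment> \<open>The antichain condition separates the states of different rows, so counting rows
    counts pure states.\<close>
  also have "card \<dots> = card (set vs)"
  proof (rule card_image, rule inj_onI, rule ccontr)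
    fix v w assume vw: "v \<in> set vs" "w \<in> set vs" "state_of (f v) = state_of (f w)" "v \<noteq> w"
    then obtain a where "a \<in> {1..n}" "f v a = 0" "f w a \<noteq> 0"
      using antichain by blast
    then show False
      using vw(3) state_of_simps(2) by metis
  qed
  also have "\<dots> = k"
    using table \<open>length vs = k\<close> by (simp add: vertex_table_def distinct_card)
  finally have "card (pure_states L) = k" .
  moreover have "card (atoms L) \<le> 19"
    using \<open>n \<le> 19\<close> by (simp add: atoms_eq)
  moreover have "finite (carrier L)"
    by simp
  ultimately show ?thesis
    unfolding realizable_def using homogeneous_L orthomodular_poset_axioms by blast
qed

text \<open>This keeps \<open>w 1\<close> from becoming \<open>w (Suc 0)\<close> and unfolds the
  index ranges into literal lists.\<close>

declare One_nat_def [simp del] upt_conv_Cons [simp]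

section \<open>The configurations\<close>

text \<open>
  The rows of \<open>?vs\<close> are the weights of minimal support, scaled to be integral. The equations
  \<open>eqs\<close> express \<open>w\<close> by facet coordinates of the polytope of weights, and the inequalities with
  several summands say which sets of facets have no common point.
\<close>

lemma realizable_values:
  "realizable 1" "realizable 2" "realizable 3" "realizable 4" "realizable 5" "realizable 6"
  "realizable 7" "realizable 10" "realizable 11"
proof -
  show "realizable 1"
  proof (rule realizableI)
    let ?bs = "[[1, 2, 3], [1, 4, 5], [1, 6, 7], [2, 8, 9], [2, 10, 11], [3, 12, 13], [3, 14, 15],
        [4, 9, 19], [4, 10, 14], [14, 7, 17], [10, 6, 13], [6, 15, 16], [15, 18, 19], [9, 12, 16],
        [16, 5, 11], [12, 7, 18], [11, 17, 19], [17, 8, 13], [5, 8, 18]]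
      :: nat list list"
    let ?vs = "[[1, 1, 1, 1, 1, 1, 1, 1, 1, 1, 1, 1, 1, 1, 1, 1, 1, 1, 1]]
      :: nat list list"
    show "configuration 19 ?bs" "vertex_table 19 ?bs 3 ?vs"
      by code_simp+
    show "19 \<le> (19 :: nat)" "length ?vs = 1"
      by simp_all
    fix w :: "nat \<Rightarrow> real"
    assume nonneg: "list_all (\<lambda>a. 0 \<le> w a) [1..<Suc 19]"
      and sums: "list_all (\<lambda>B. sum_list (map w B) = 1) ?bs"
    \<comment> \<open>The block equations alone have a unique solution, so the polytope is a
      point.\<close>
    have eqs: "w 1 = 1 / 3" "w 2 = 1 / 3" "w 3 = 1 / 3" "w 4 = 1 / 3" "w 5 = 1 / 3" "w 6 = 1 / 3"
      "w 7 = 1 / 3" "w 8 = 1 / 3" "w 9 = 1 / 3" "w 10 = 1 / 3" "w 11 = 1 / 3" "w 12 = 1 / 3"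
      "w 13 = 1 / 3" "w 14 = 1 / 3" "w 15 = 1 / 3" "w 16 = 1 / 3" "w 17 = 1 / 3" "w 18 = 1 / 3"
      "w 19 = 1 / 3"
      using sums[simplified] by argo+
    show "\<exists>v\<in>set ?vs. list_all2 (\<lambda>a x. w a = 0 \<longrightarrow> x = 0) [1..<Suc 19] v"
      by (simp add: eqs)
  qed
  show "realizable 2"
  proof (rule realizableI)
    let ?bs = "[[1, 2, 3], [1, 4, 5], [1, 6, 7], [2, 8, 9], [2, 10, 11], [3, 12, 13], [3, 14, 15],
        [4, 8, 12], [4, 10, 14], [5, 9, 15], [5, 11, 16], [6, 9, 13], [6, 14, 16], [7, 11, 12],
        [7, 15, 17], [8, 16, 17], [10, 13, 17]]
      :: nat list list"
    let ?vs = "[[0, 1, 2, 1, 2, 2, 1, 1, 1, 1, 1, 1, 0, 1, 0, 0, 2],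
        [2, 1, 0, 1, 0, 0, 1, 1, 1, 1, 1, 1, 2, 1, 2, 2, 0]]
      :: nat list list"
    show "configuration 17 ?bs" "vertex_table 17 ?bs 3 ?vs"
      by code_simp+
    show "17 \<le> (19 :: nat)" "length ?vs = 2"
      by simp_all
    fix w :: "nat \<Rightarrow> real"
    assume nonneg: "list_all (\<lambda>a. 0 \<le> w a) [1..<Suc 17]"
      and sums: "list_all (\<lambda>B. sum_list (map w B) = 1) ?bs"
    have eqs: "w 2 = 1 / 3" "w 4 = 1 / 3" "w 5 = w 3" "w 6 = w 3" "w 7 = 1 / 3" "w 8 = 1 / 3"
      "w 9 = 1 / 3" "w 10 = 1 / 3" "w 11 = 1 / 3" "w 12 = 1 / 3" "w 13 = w 1" "w 14 = 1 / 3"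
      "w 15 = w 1" "w 16 = w 1" "w 17 = w 3"
      using sums[simplified] by argo+
    \<comment> \<open>Since \<open>w 2 = 1 / 3\<close>, the two coordinates sum to 2/3 and the
      polytope is a segment.\<close>
    have "0 < w 1 + w 3"
      using nonneg[simplified] sums[simplified] by argo+
    then show "\<exists>v\<in>set ?vs. list_all2 (\<lambda>a x. w a = 0 \<longrightarrow> x = 0) [1..<Suc 17] v"
      by (simp add: eqs)
  qed
  show "realizable 3"
  proof (rule realizableI)
    let ?bs = "[[1, 2, 3], [1, 4, 5], [1, 6, 7], [2, 8, 9], [2, 10, 11], [3, 12, 13], [3, 14, 15],
        [4, 15, 16], [4, 8, 17], [8, 6, 18], [15, 10, 18], [18, 5, 12], [5, 9, 14], [9, 13, 16],
        [16, 6, 11], [11, 12, 17], [10, 7, 13], [7, 14, 17]]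
      :: nat list list"
    let ?vs = "[[0, 0, 1, 1, 0, 0, 1, 0, 1, 0, 1, 0, 0, 0, 0, 0, 0, 1],
        [0, 1, 0, 0, 1, 1, 0, 0, 0, 0, 0, 0, 1, 0, 1, 0, 1, 0],
        [1, 0, 0, 0, 0, 0, 0, 1, 0, 1, 0, 1, 0, 1, 0, 1, 0, 0]]
      :: nat list list"
    show "configuration 18 ?bs" "vertex_table 18 ?bs 1 ?vs"
      by code_simp+
    show "18 \<le> (19 :: nat)" "length ?vs = 3"
      by simp_all
    fix w :: "nat \<Rightarrow> real"
    assume nonneg: "list_all (\<lambda>a. 0 \<le> w a) [1..<Suc 18]"
      and sums: "list_all (\<lambda>B. sum_list (map w B) = 1) ?bs"
    \<comment> \<open>The points fall into three classes of equal weight and each block meets every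
      class once. The polytope is a triangle whose vertices are the indicators of the
      classes.\<close>
    have eqs: "w 4 = w 3" "w 5 = w 2" "w 6 = w 2" "w 7 = w 3" "w 8 = w 1" "w 9 = w 3" "w 10 = w 1"
      "w 11 = w 3" "w 12 = w 1" "w 13 = w 2" "w 14 = w 1" "w 15 = w 2" "w 16 = w 1" "w 17 = w 2"
      "w 18 = w 3"
      using sums[simplified] by argo+
    have "0 < w 1 + w 2 + w 3"
      using nonneg[simplified] sums[simplified] by argo+
    then show "\<exists>v\<in>set ?vs. list_all2 (\<lambda>a x. w a = 0 \<longrightarrow> x = 0) [1..<Suc 18] v"
      by (simp add: eqs)
  qed
  show "realizable 4"
  proof (rule realizableI)
    let ?bs = "[[1, 2, 3], [1, 4, 5], [1, 6, 7], [2, 8, 9], [2, 10, 11], [3, 12, 13], [3, 14, 15],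
        [4, 15, 17], [4, 9, 18], [9, 7, 19], [15, 7, 11], [11, 12, 16], [12, 6, 18], [18, 10, 14],
        [6, 8, 17], [8, 5, 13], [13, 10, 19], [5, 14, 16], [16, 17, 19]]
      :: nat list list"
    let ?vs = "[[0, 3, 6, 6, 3, 3, 6, 6, 0, 6, 0, 3, 0, 0, 3, 6, 0, 3, 3],
        [2, 5, 2, 6, 1, 3, 4, 4, 0, 0, 4, 3, 4, 6, 1, 2, 2, 3, 5],
        [4, 1, 4, 0, 5, 3, 2, 2, 6, 6, 2, 3, 2, 0, 5, 4, 4, 3, 1],
        [6, 3, 0, 0, 3, 3, 0, 0, 6, 0, 6, 3, 6, 6, 3, 0, 6, 3, 3]]
      :: nat list list"
    show "configuration 19 ?bs" "vertex_table 19 ?bs 9 ?vs"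
      by code_simp+
    show "19 \<le> (19 :: nat)" "length ?vs = 4"
      by simp_all
    fix w :: "nat \<Rightarrow> real"
    assume nonneg: "list_all (\<lambda>a. 0 \<le> w a) [1..<Suc 19]"
      and sums: "list_all (\<lambda>B. sum_list (map w B) = 1) ?bs"
    have eqs: "w 1 = 2 * w 9 / 3 + w 14 / 3" "w 3 = w 4 / 3 + 2 * w 10 / 3" "w 6 = 1 / 3"
      "w 7 = 2 * w 4 / 3 + w 10 / 3" "w 8 = 2 * w 4 / 3 + w 10 / 3"
      "w 11 = w 9 / 3 + 2 * w 14 / 3" "w 12 = 1 / 3" "w 13 = w 9 / 3 + 2 * w 14 / 3"
      "w 16 = w 4 / 3 + 2 * w 10 / 3" "w 17 = 2 * w 9 / 3 + w 14 / 3" "w 18 = 1 / 3"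
      using sums[simplified] by argo+
    \<comment> \<open>The polytope is a quadrilateral whose opposite sides are the zero sets of
      \<open>w 4\<close>, \<open>w 9\<close> and of \<open>w 10\<close>, \<open>w 14\<close>. The
      nonnegativity facts are kept so that a vanishing combination such as \<open>w 1\<close> forces
      both its summands to vanish.\<close>
    have "0 < w 2" "0 < w 5" "0 < w 15" "0 < w 19" "0 < w 4 + w 9" "0 < w 10 + w 14" "0 \<le> w 4"
      "0 \<le> w 9" "0 \<le> w 10" "0 \<le> w 14"
      using nonneg[simplified] sums[simplified] by argo+
    then show "\<exists>v\<in>set ?vs. list_all2 (\<lambda>a x. w a = 0 \<longrightarrow> x = 0) [1..<Suc 19] v"
      by (simp add: eqs) argo
  qed
  show "realizable 5"
  proof (rule realizableI)
    let ?bs = "[[1, 2, 3], [1, 4, 5], [1, 6, 7], [2, 8, 9], [2, 10, 11], [3, 12, 13], [3, 14, 15],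
        [4, 13, 19], [4, 11, 14], [11, 12, 18], [14, 7, 8], [7, 13, 17], [8, 5, 16], [12, 6, 16],
        [5, 15, 18], [16, 10, 17], [10, 15, 19], [6, 9, 19], [9, 17, 18]]
      :: nat list list"
    let ?vs = "[[0, 1, 2, 2, 1, 0, 3, 0, 2, 1, 1, 1, 0, 0, 1, 2, 0, 1, 1],
        [0, 1, 2, 2, 1, 2, 1, 2, 0, 1, 1, 1, 0, 0, 1, 0, 2, 1, 1],
        [1, 1, 1, 1, 1, 2, 0, 2, 0, 1, 1, 1, 1, 1, 1, 0, 2, 1, 1],
        [2, 1, 0, 0, 1, 0, 1, 0, 2, 1, 1, 1, 2, 2, 1, 2, 0, 1, 1],
        [2, 1, 0, 0, 1, 1, 0, 1, 1, 1, 1, 1, 2, 2, 1, 1, 1, 1, 1]]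
      :: nat list list"
    show "configuration 19 ?bs" "vertex_table 19 ?bs 3 ?vs"
      by code_simp+
    show "19 \<le> (19 :: nat)" "length ?vs = 5"
      by simp_all
    fix w :: "nat \<Rightarrow> real"
    assume nonneg: "list_all (\<lambda>a. 0 \<le> w a) [1..<Suc 19]"
      and sums: "list_all (\<lambda>B. sum_list (map w B) = 1) ?bs"
    have eqs: "w 2 = 1 / 3" "w 4 = w 3" "w 5 = 1 / 3" "w 8 = w 6" "w 10 = 1 / 3" "w 11 = 1 / 3"
      "w 12 = 1 / 3" "w 13 = w 1" "w 14 = w 1" "w 15 = 1 / 3" "w 16 = w 9" "w 17 = w 6"
      "w 18 = 1 / 3" "w 19 = 1 / 3"
      using sums[simplified] by argo+
    \<comment> \<open>A pentagon with sides given by the coordinates 1, 3, 6, 7, 9; the pairs are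
      its five pairs of nonadjacent sides.\<close>
    have "0 < w 1 + w 3" "0 < w 1 + w 7" "0 < w 3 + w 9" "0 < w 6 + w 7" "0 < w 6 + w 9"
      using nonneg[simplified] sums[simplified] by argo+
    then show "\<exists>v\<in>set ?vs. list_all2 (\<lambda>a x. w a = 0 \<longrightarrow> x = 0) [1..<Suc 19] v"
      by (simp add: eqs) argo
  qed
  show "realizable 6"
  proof (rule realizableI)
    let ?bs = "[[1, 2, 3], [1, 4, 5], [1, 6, 7], [2, 8, 9], [2, 10, 11], [3, 12, 13], [3, 14, 15],
        [4, 9, 17], [4, 11, 18], [5, 8, 16], [5, 12, 19], [8, 6, 14], [9, 7, 15], [14, 18, 19],
        [15, 10, 16], [19, 10, 17], [16, 13, 18], [7, 11, 12], [6, 13, 17]]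
      :: nat list list"
    let ?vs = "[[0, 4, 2, 4, 2, 2, 4, 2, 0, 2, 0, 2, 2, 2, 2, 2, 2, 2, 2],
        [0, 4, 2, 5, 1, 2, 4, 2, 0, 1, 1, 1, 3, 2, 2, 3, 1, 0, 4],
        [1, 3, 2, 2, 3, 2, 3, 2, 1, 3, 0, 3, 1, 2, 2, 1, 3, 4, 0],
        [3, 1, 2, 0, 3, 2, 1, 2, 3, 3, 2, 3, 1, 2, 2, 1, 3, 4, 0],
        [4, 0, 2, 0, 2, 2, 0, 2, 4, 2, 4, 2, 2, 2, 2, 2, 2, 2, 2],
        [4, 0, 2, 1, 1, 2, 0, 2, 4, 1, 5, 1, 3, 2, 2, 3, 1, 0, 4]]
      :: nat list list"
    show "configuration 19 ?bs" "vertex_table 19 ?bs 6 ?vs"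
      by code_simp+
    show "19 \<le> (19 :: nat)" "length ?vs = 6"
      by simp_all
    fix w :: "nat \<Rightarrow> real"
    assume nonneg: "list_all (\<lambda>a. 0 \<le> w a) [1..<Suc 19]"
      and sums: "list_all (\<lambda>B. sum_list (map w B) = 1) ?bs"
    have eqs: "w 3 = 1 / 3" "w 6 = 1 / 3" "w 7 = w 2" "w 8 = 1 / 3" "w 9 = w 1" "w 14 = 1 / 3"
      "w 15 = 1 / 3"
      using sums[simplified] by argo+
    \<comment> \<open>A hexagon with sides 1, 2, 4, 11, 18, 19. The six pairs of these that are not
      listed are the vertices.\<close>
    have "0 < w 5" "0 < w 10" "0 < w 12" "0 < w 13" "0 < w 16" "0 < w 17" "0 < w 1 + w 2"
      "0 < w 1 + w 4" "0 < w 1 + w 19" "0 < w 2 + w 11" "0 < w 2 + w 19" "0 < w 4 + w 11"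
      "0 < w 4 + w 18" "0 < w 11 + w 18" "0 < w 18 + w 19"
      using nonneg[simplified] sums[simplified] by argo+
    then show "\<exists>v\<in>set ?vs. list_all2 (\<lambda>a x. w a = 0 \<longrightarrow> x = 0) [1..<Suc 19] v"
      by (simp add: eqs) argo
  qed
  show "realizable 7"
  proof (rule realizableI)
    let ?bs = "[[1, 2, 3], [1, 4, 5], [1, 6, 7], [2, 8, 9], [2, 10, 11], [3, 12, 13], [3, 14, 15],
        [4, 11, 16], [4, 9, 15], [15, 6, 17], [9, 7, 12], [7, 11, 18], [6, 13, 16], [16, 8, 14],
        [13, 5, 18], [12, 10, 17], [10, 5, 14], [8, 17, 18]]
      :: nat list list"
    let ?vs = "[[0, 1, 1, 1, 1, 0, 2, 1, 0, 1, 0, 0, 1, 0, 1, 1, 1, 0],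
        [0, 1, 1, 1, 1, 1, 1, 1, 0, 1, 0, 1, 0, 0, 1, 1, 0, 1],
        [0, 2, 0, 2, 0, 0, 2, 0, 0, 0, 0, 0, 2, 2, 0, 0, 2, 0],
        [0, 2, 0, 2, 0, 2, 0, 0, 0, 0, 0, 2, 0, 2, 0, 0, 0, 2],
        [1, 0, 1, 0, 1, 0, 1, 1, 1, 1, 1, 0, 1, 0, 1, 1, 1, 0],
        [1, 0, 1, 0, 1, 1, 0, 1, 1, 1, 1, 1, 0, 0, 1, 1, 0, 1],
        [2, 0, 0, 0, 0, 0, 0, 0, 2, 0, 2, 0, 2, 2, 0, 0, 2, 0]]
      :: nat list list"
    show "configuration 18 ?bs" "vertex_table 18 ?bs 2 ?vs"
      by code_simp+
    show "18 \<le> (19 :: nat)" "length ?vs = 7"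
      by simp_all
    fix w :: "nat \<Rightarrow> real"
    assume nonneg: "list_all (\<lambda>a. 0 \<le> w a) [1..<Suc 18]"
      and sums: "list_all (\<lambda>B. sum_list (map w B) = 1) ?bs"
    have eqs: "w 4 = w 2" "w 5 = w 3" "w 8 = w 3" "w 9 = w 1" "w 10 = w 3" "w 11 = w 1" "w 12 = w 6"
      "w 15 = w 3" "w 16 = w 3" "w 17 = w 13" "w 18 = w 6"
      using sums[simplified] by argo+
    \<comment> \<open>The triples are facets that meet pairwise without a common point.\<close>
    have "0 < w 1 + w 2" "0 < w 3 + w 14" "0 < w 6 + w 13" "0 < w 1 + w 6 + w 7"
      "0 < w 1 + w 7 + w 14" "0 < w 2 + w 3 + w 13" "0 < w 6 + w 7 + w 14"
      using nonneg[simplified] sums[simplified] by argo+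
    then show "\<exists>v\<in>set ?vs. list_all2 (\<lambda>a x. w a = 0 \<longrightarrow> x = 0) [1..<Suc 18] v"
      by (simp add: eqs) argo
  qed
  show "realizable 10"
  proof (rule realizableI)
    let ?bs = "[[1, 2, 3], [1, 4, 5], [1, 6, 7], [2, 8, 9], [2, 10, 11], [3, 12, 13], [3, 14, 15],
        [4, 15, 18], [4, 12, 17], [5, 8, 14], [5, 11, 13], [13, 16, 18], [11, 7, 17], [12, 6, 10],
        [10, 14, 16], [17, 9, 16], [7, 8, 18], [6, 9, 15]]
      :: nat list list"
    let ?vs = "[[0, 0, 2, 2, 0, 2, 0, 2, 0, 0, 2, 0, 0, 0, 0, 2, 0, 0],
        [0, 1, 1, 1, 1, 1, 1, 0, 1, 0, 1, 1, 0, 1, 0, 1, 0, 1],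
        [0, 1, 1, 1, 1, 1, 1, 0, 1, 1, 0, 0, 1, 1, 0, 0, 1, 1],
        [0, 1, 1, 1, 1, 1, 1, 1, 0, 1, 0, 0, 1, 0, 1, 1, 1, 0],
        [0, 2, 0, 0, 2, 0, 2, 0, 0, 0, 0, 2, 0, 0, 2, 2, 0, 0],
        [1, 0, 1, 1, 0, 1, 0, 1, 1, 1, 1, 0, 1, 1, 0, 0, 1, 1],
        [1, 1, 0, 0, 1, 0, 1, 0, 1, 1, 0, 1, 1, 1, 1, 0, 1, 1],
        [2, 0, 0, 0, 0, 0, 0, 0, 2, 0, 2, 2, 0, 2, 0, 0, 0, 2],
        [2, 0, 0, 0, 0, 0, 0, 2, 0, 0, 2, 2, 0, 0, 2, 2, 0, 0],
        [2, 0, 0, 0, 0, 0, 0, 2, 0, 2, 0, 0, 2, 0, 2, 0, 2, 0]]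
      :: nat list list"
    show "configuration 18 ?bs" "vertex_table 18 ?bs 2 ?vs"
      by code_simp+
    show "18 \<le> (19 :: nat)" "length ?vs = 10"
      by simp_all
    fix w :: "nat \<Rightarrow> real"
    assume nonneg: "list_all (\<lambda>a. 0 \<le> w a) [1..<Suc 18]"
      and sums: "list_all (\<lambda>B. sum_list (map w B) = 1) ?bs"
    have eqs: "w 4 = w 3" "w 5 = w 2" "w 6 = w 3" "w 7 = w 2" "w 13 = w 10" "w 14 = w 9" "w 17 = w 10"
      "w 18 = w 9"
      using sums[simplified] by argo+
    \<comment> \<open>Any two of these coordinates vanish together in some row, so triples are the
      smallest sets that can be excluded.\<close>
    have "0 < w 1 + w 2 + w 3" "0 < w 1 + w 2 + w 8" "0 < w 1 + w 2 + w 11" "0 < w 1 + w 2 + w 16"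
      "0 < w 1 + w 3 + w 12" "0 < w 1 + w 3 + w 15" "0 < w 1 + w 3 + w 16" "0 < w 1 + w 9 + w 16"
      "0 < w 1 + w 10 + w 16" "0 < w 2 + w 8 + w 9" "0 < w 2 + w 8 + w 11" "0 < w 2 + w 8 + w 12"
      "0 < w 2 + w 10 + w 11" "0 < w 2 + w 11 + w 15" "0 < w 3 + w 8 + w 12"
      "0 < w 3 + w 9 + w 15" "0 < w 3 + w 10 + w 12" "0 < w 3 + w 11 + w 15"
      "0 < w 3 + w 12 + w 15" "0 < w 8 + w 9 + w 12" "0 < w 8 + w 9 + w 15" "0 < w 8 + w 9 + w 16"
      "0 < w 8 + w 10 + w 12" "0 < w 9 + w 10 + w 16" "0 < w 9 + w 11 + w 15"
      "0 < w 9 + w 15 + w 16" "0 < w 10 + w 11 + w 12" "0 < w 10 + w 11 + w 15"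
      "0 < w 10 + w 11 + w 16" "0 < w 10 + w 12 + w 16"
      using nonneg[simplified] sums[simplified] by argo+
    then show "\<exists>v\<in>set ?vs. list_all2 (\<lambda>a x. w a = 0 \<longrightarrow> x = 0) [1..<Suc 18] v"
      by (simp add: eqs) argo
  qed
  show "realizable 11"
  proof (rule realizableI)
    let ?bs = "[[1, 2, 3], [1, 4, 5], [1, 6, 7], [2, 8, 9], [2, 10, 11], [3, 12, 13], [3, 14, 15],
        [4, 13, 18], [4, 14, 16], [5, 10, 17], [5, 8, 19], [8, 6, 18], [18, 11, 15], [15, 9, 17],
        [14, 7, 19], [19, 11, 12], [9, 12, 16], [6, 10, 16], [7, 13, 17]]
      :: nat list list"
    let ?vs = "[[0, 0, 3, 2, 1, 1, 2, 1, 2, 1, 2, 0, 0, 0, 0, 1, 1, 1, 1],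
        [0, 1, 2, 1, 2, 2, 1, 0, 2, 0, 2, 0, 1, 1, 0, 1, 1, 1, 1],
        [0, 2, 1, 2, 1, 1, 2, 1, 0, 1, 0, 2, 0, 0, 2, 1, 1, 1, 1],
        [0, 3, 0, 1, 2, 2, 1, 0, 0, 0, 0, 2, 1, 1, 2, 1, 1, 1, 1],
        [1, 0, 2, 2, 0, 0, 2, 2, 1, 2, 1, 1, 0, 0, 1, 1, 1, 1, 1],
        [1, 1, 1, 0, 2, 2, 0, 0, 2, 0, 2, 0, 2, 2, 0, 1, 1, 1, 1],
        [1, 1, 1, 2, 0, 0, 2, 2, 0, 2, 0, 2, 0, 0, 2, 1, 1, 1, 1],
        [1, 2, 0, 0, 2, 2, 0, 0, 1, 0, 1, 1, 2, 2, 1, 1, 1, 1, 1],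
        [2, 0, 1, 0, 1, 1, 0, 1, 2, 1, 2, 0, 2, 2, 0, 1, 1, 1, 1],
        [2, 1, 0, 1, 0, 0, 1, 2, 0, 2, 0, 2, 1, 1, 2, 1, 1, 1, 1],
        [3, 0, 0, 0, 0, 0, 0, 2, 1, 2, 1, 1, 2, 2, 1, 1, 1, 1, 1]]
      :: nat list list"
    show "configuration 19 ?bs" "vertex_table 19 ?bs 3 ?vs"
      by code_simp+
    show "19 \<le> (19 :: nat)" "length ?vs = 11"
      by simp_all
    fix w :: "nat \<Rightarrow> real"
    assume nonneg: "list_all (\<lambda>a. 0 \<le> w a) [1..<Suc 19]"
      and sums: "list_all (\<lambda>B. sum_list (map w B) = 1) ?bs"
    have eqs: "w 6 = w 5" "w 7 = w 4" "w 10 = w 8" "w 11 = w 9" "w 14 = w 13" "w 15 = w 12" "w 16 = 1 / 3"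
      "w 17 = 1 / 3" "w 18 = 1 / 3" "w 19 = 1 / 3"
      using sums[simplified] by argo+
    have "0 < w 1 + w 4" "0 < w 1 + w 5" "0 < w 2 + w 8" "0 < w 2 + w 9" "0 < w 3 + w 12"
      "0 < w 3 + w 13" "0 < w 4 + w 9" "0 < w 4 + w 13" "0 < w 5 + w 8" "0 < w 5 + w 12"
      "0 < w 8 + w 13" "0 < w 9 + w 12" "0 < w 1 + w 2 + w 3"
      using nonneg[simplified] sums[simplified] by argo+
    then show "\<exists>v\<in>set ?vs. list_all2 (\<lambda>a x. w a = 0 \<longrightarrow> x = 0) [1..<Suc 19] v"
      by (simp add: eqs) argo
  qed
qed

theorem theorem2p2:
  fixes k :: nat
  assumes "k \<in> {1, 2, 3, 4, 5, 6, 7, 10, 11}"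
  shows "\<exists>L :: nat ortho_poset. orthomodular_poset L \<and> finite (carrier L) \<and>
    homogeneous 3 3 L \<and> card (atoms L) \<le> 19 \<and> card (pure_states L) = k"
proof -
  have "realizable k"
    using assms realizable_values by auto
  then show ?thesis
    unfolding realizable_def .
qed

end
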